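(* Let $V:\mathbb R^m\times[0,1]\to\mathbb R$ be the (unique) viscosity solution of the Hamilton–Jacobi–Isaacs equation $$\partial_t V(x,t)+H(\nabla_x V(x,t))=0\ \ \text{on }\mathbb R^m\times[0,1),\qquad V(x,1)=g(x)\ \ \forall x\in\mathbb R^m.$$ Then $R^{go}_\infty=V(0,0)$.
   Context: Simple-hypothesis setting: $\mathcal X$ is a finite set, $\Delta_{\mathcal X}$ the probability distributions on $\mathcal X$, $\Delta_K$ the simplex on $[K]$, $D$ the KL divergence. Fix $m\ge2$ bandits $\nu^1,\dots,\nu^m$, $\nu^i=(\nu^i_a)_{a\in[K]}$ with $\nu^i_a\in\Delta_{\mathcal X}$ and $\nu^i_a(x)\ge\epsilon>0$ for all $i,a,x$. For $B\in\mathbb N$, sample paths $Q^B=(Q_1,\dots,Q_B)$ with $Q_l=(Q_{l,a})_a\in(\Delta_{\mathcal X})^K$, $Q^l=(Q_1,\dots,Q_l)$; allocation rules $r^B=(r_1,\dots,r_B)$ with $r_l:((\Delta_{\mathcal X})^K)^l\to\Delta_K$ arbitrary; decision rules $J:((\Delta_{\mathcal X})^K)^B\to[m]$ arbitrary. Define $R^{go}_B=\sup_{r^B,J}\inf_{Q^B}\min_{i\ne J(Q^B)}\frac1B\sum_{l=1}^B\sum_a r_l(Q^l)(a)D(Q_{l,a}\|\nu^i_a)$ and $R^{go}_\infty=\lim_{B\to\infty}R^{go}_B$ (the limit is known to exist). The Hamiltonian is $$H(p)=\min_{Q\in(\Delta_{\mathcal X})^K}\max_{w\in\Delta_K}\sum_{i=1}^m\sum_{a\in[K]}w(a)D(Q_a\|\nu^i_a)p_i,\quad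 p\in\mathbb R^m,$$ and the terminal function is $g(x)=\max_{j\in[m]}\min_{i\ne j}x_i$ (the second smallest coordinate of $x$). *)

theory Defs
  imports "HOL-Analysis.Analysis"
begin

definition prob_simplex :: "('b::finite \<Rightarrow> real) set" where
  "prob_simplex = {p. (\<forall>b. 0 \<le> p b) \<and> sum p UNIV = 1}"

definition KL :: "('x::finite \<Rightarrow> real) \<Rightarrow> ('x \<Rightarrow> real) \<Rightarrow> real" where
  "KL q p = (\<Sum>x\<in>UNIV. if q x = 0 then 0 else q x * ln (q x / p x))"

definition obs_profile :: "('a::finite \<Rightarrow> 'x::finite \<Rightarrow> real) set" where
  "obs_profile = {Q. \<forall>a. Q a \<in> prob_simplex}"

text \<open>Sample paths Q^B = (Q_1,...,Q_B) as lists of length B (entry l-1 is Q_l).\<close>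
definition paths :: "nat \<Rightarrow> ('a::finite \<Rightarrow> 'x::finite \<Rightarrow> real) list set" where
  "paths B = {Qs. length Qs = B \<and> set Qs \<subseteq> obs_profile}"

text \<open>An allocation rule r^B = (r_1,...,r_B) is encoded as one function on lists:
  r_l is its restriction to lists of length l (the prefixes Q^l).\<close>
definition alloc_rule :: "nat \<Rightarrow> (('a::finite \<Rightarrow> 'x::finite \<Rightarrow> real) list \<Rightarrow> 'a \<Rightarrow> real) \<Rightarrow> bool" where
  "alloc_rule B r \<longleftrightarrow> (\<forall>Qs. 1 \<le> length Qs \<and> length Qs \<le> B \<and> set Qs \<subseteq> obs_profile \<longrightarrow> r Qs \<in> prob_simplex)"

definition objective ::
  "('i \<Rightarrow> 'a::finite \<Rightarrow> 'x::finite \<Rightarrow> real) \<Rightarrow> nat \<Rightarrow> (('a \<Rightarrow> 'x \<Rightarrow> real) list \<Rightarrow> 'a \<Rightarrow> real)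
     \<Rightarrow> ('a \<Rightarrow> 'x \<Rightarrow> real) list \<Rightarrow> 'i \<Rightarrow> real" where
  "objective \<nu> B r Qs i =
     (1 / real B) * (\<Sum>l<B. \<Sum>a\<in>UNIV. r (take (Suc l) Qs) a * KL ((Qs ! l) a) (\<nu> i a))"

definition R_go ::
  "('i::finite \<Rightarrow> 'a::finite \<Rightarrow> 'x::finite \<Rightarrow> real) \<Rightarrow> nat \<Rightarrow> real" where
  "R_go \<nu> B = Sup {Inf {Min {objective \<nu> B r Qs i | i. i \<noteq> J Qs} | Qs. Qs \<in> paths B}
                   | r J. alloc_rule B r}"

definition Ham ::
  "('i::finite \<Rightarrow> 'a::finite \<Rightarrow> 'x::finite \<Rightarrow> real) \<Rightarrow> real^'i \<Rightarrow> real" where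
  "Ham \<nu> p = Inf {Sup {(\<Sum>i\<in>UNIV. \<Sum>a\<in>UNIV. w a * KL (Q a) (\<nu> i a) * p $ i) | w. w \<in> prob_simplex}
                  | Q. Q \<in> obs_profile}"

definition gterm :: "real^'i::finite \<Rightarrow> real" where
  "gterm x = Max (range (\<lambda>j. Min {x $ i | i. i \<noteq> j}))"

definition C1_test ::
  "(real^'i::finite \<Rightarrow> real \<Rightarrow> real) \<Rightarrow> (real^'i \<Rightarrow> real \<Rightarrow> real^'i) \<Rightarrow> (real^'i \<Rightarrow> real \<Rightarrow> real) \<Rightarrow> bool" where
  "C1_test \<phi> Dx Dt \<longleftrightarrow>
     (\<forall>x t. ((\<lambda>(y, s). \<phi> y s) has_derivative (\<lambda>(h, k). Dx x t \<bullet> h + Dt x t * k)) (at (x, t)))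
     \<and> continuous_on UNIV (\<lambda>(x, t). Dx x t) \<and> continuous_on UNIV (\<lambda>(x, t). Dt x t)"

text \<open>Viscosity solution of the terminal value problem
  d_t V + H(grad_x V) = 0 on R^m x (0,1), V(x,1) = g(x), V continuous on R^m x [0,1]
  (convention for terminal problems, as obtained by time reversal, cf. Evans--Souganidis).\<close>
definition viscosity_solution ::
  "(real^'i::finite \<Rightarrow> real) \<Rightarrow> (real^'i \<Rightarrow> real) \<Rightarrow> (real^'i \<Rightarrow> real \<Rightarrow> real) \<Rightarrow> bool" where
  "viscosity_solution H g V \<longleftrightarrow>
     continuous_on (UNIV \<times> {0..1}) (\<lambda>(x, t). V x t)
     \<and> (\<forall>x. V x 1 = g x)
     \<and> (\<forall>\<phi> Dx Dt x0 t0. C1_test \<phi> Dx Dt \<and> 0 < t0 \<and> t0 < 1 \<and>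
          (\<exists>e>0. \<forall>y s. dist (y, s) (x0, t0) < e \<longrightarrow> V y s - \<phi> y s \<le> V x0 t0 - \<phi> x0 t0)
          \<longrightarrow> Dt x0 t0 + H (Dx x0 t0) \<ge> 0)
     \<and> (\<forall>\<phi> Dx Dt x0 t0. C1_test \<phi> Dx Dt \<and> 0 < t0 \<and> t0 < 1 \<and>
          (\<exists>e>0. \<forall>y s. dist (y, s) (x0, t0) < e \<longrightarrow> V y s - \<phi> y s \<ge> V x0 t0 - \<phi> x0 t0)
          \<longrightarrow> Dt x0 t0 + H (Dx x0 t0) \<le> 0)"

end

theory Submission
  imports Defs
begin

text \<open>
  By dynamic programming, \<open>R_go \<nu> B\<close> is the value at \<open>(0, 0)\<close> of the recursion
  \<open>U\<^sub>n\<^sub>+\<^sub>1 x = inf\<^sub>Q sup\<^sub>w U\<^sub>n (x + f(Q, w) / B)\<close>, \<open>U\<^sub>0 = g\<close>, where \<open>f(Q, w)\<^sub>i = \<Sum>\<^sub>a w(a) D(Q\<^sub>a || \<nu>\<^sup>i\<^sub>a)\<close> is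
  bounded because \<open>\<nu> \<ge> \<epsilon>\<close>. This is a monotone scheme for the Isaacs equation that is Lipschitz
  uniformly in \<open>B\<close>, and doubling of variables compares it directly with a viscosity
  supersolution. The reverse inequality is the same comparison applied to \<open>-U\<close>, \<open>-V\<close> and the
  Hamiltonian \<open>p \<mapsto> -H(-p)\<close>.
\<close>

subsection \<open>Viscosity supersolutions and test functions\<close>

text \<open>The comparison is proved for an abstract family \<open>U\<close> with a one-sided
  consistency estimate. This is what lets it apply to \<open>-U\<close>, which obeys a sup-inf
  recursion and is not a value of the same game. Consistency is only tested on quadratics, since the
  doubling penalty in the scheme's space variable is an exact quadratic; no regularity of
  \<open>U\<close> beyond its Lipschitz bound enters. The discrete step is kept inside the doubling:
  the maximum is taken jointly over the number \<open>n\<close> of remaining rounds and the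
  continuous variables. The penalties give a strict margin \<open>\<eta>\<close>, fixed before
  \<open>B\<close> is chosen, and the discretisation error of order \<open>1/B\<close> is finally
  pushed below it.\<close>

definition viscosity_supersolution ::
  "(real^'i::finite \<Rightarrow> real) \<Rightarrow> (real^'i \<Rightarrow> real \<Rightarrow> real) \<Rightarrow> bool" where
  "viscosity_supersolution H V \<longleftrightarrow>
     (\<forall>\<phi> Dx Dt x0 t0. C1_test \<phi> Dx Dt \<and> 0 < t0 \<and> t0 < 1 \<and>
        (\<exists>e>0. \<forall>y s. dist (y, s) (x0, t0) < e \<longrightarrow> V x0 t0 - \<phi> x0 t0 \<le> V y s - \<phi> y s)
        \<longrightarrow> Dt x0 t0 + H (Dx x0 t0) \<le> 0)"

lemma C1_test_uminus:
  assumes "C1_test \<phi> Dx Dt"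
  shows "C1_test (\<lambda>x t. - \<phi> x t) (\<lambda>x t. - Dx x t) (\<lambda>x t. - Dt x t)"
proof -
  have "((\<lambda>z. - (case z of (y, s) \<Rightarrow> \<phi> y s)) has_derivative
      (\<lambda>z. - (case z of (h, k) \<Rightarrow> Dx x t \<bullet> h + Dt x t * k))) (at (x, t))" for x t
    using assms by (intro has_derivative_minus) (auto simp: C1_test_def)
  moreover have "continuous_on UNIV (\<lambda>z. - (case z of (x, t) \<Rightarrow> Dx x t))"
    "continuous_on UNIV (\<lambda>z. - (case z of (x, t) \<Rightarrow> Dt x t))"
    using assms by (auto simp: C1_test_def intro!: continuous_on_minus)
  ultimately show ?thesis
    by (simp add: C1_test_def case_prod_unfold)
qed

lemma viscosity_solution_supersolution:
  assumes "viscosity_solution H g V"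
  shows "viscosity_supersolution H V"
  using assms unfolding viscosity_solution_def viscosity_supersolution_def by blast

text \<open>Touching \<open>-V\<close> from below by \<open>\<phi>\<close> is touching
  \<open>V\<close> from above by \<open>-\<phi>\<close>, so the subsolution half applies with both
  derivatives negated; the sign change of the gradient produces \<open>H (- p)\<close>.\<close>

lemma viscosity_solution_uminus_supersolution:
  assumes "viscosity_solution H g V"
  shows "viscosity_supersolution (\<lambda>p. - H (- p)) (\<lambda>x t. - V x t)"
  unfolding viscosity_supersolution_def
proof (intro allI impI, elim conjE exE)
  fix \<phi> Dx Dt x0 t0 e
  assume *: "C1_test \<phi> Dx Dt" "0 < t0" "t0 < 1" "0 < e"
    "\<forall>y s. dist (y, s) (x0, t0) < e \<longrightarrow> - V x0 t0 - \<phi> x0 t0 \<le> - V y s - \<phi> y s"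
  have "\<exists>e>0. \<forall>y s. dist (y, s) (x0, t0) < e \<longrightarrow> V y s - - \<phi> y s \<le> V x0 t0 - - \<phi> x0 t0"
    using *(4,5) by (intro exI[of _ e]) force
  then have "- Dt x0 t0 + H (- Dx x0 t0) \<ge> 0"
    using assms C1_test_uminus[OF *(1)] *(2,3) unfolding viscosity_solution_def by blast
  then show "Dt x0 t0 + - H (- Dx x0 t0) \<le> 0" by simp
qed

text \<open>This is the function that touches \<open>V\<close> in the doubling argument once the
  scheme's space variable \<open>a\<close> and time \<open>s\<close> are frozen. Its last summand is
  the localising penalty; the exponent \<open>Suc j\<close> avoids a subtraction in the
  gradient.\<close>

lemma C1_test_doubling:
  fixes a :: "real^'i::finite"
  assumes "\<epsilon> \<noteq> 0"
  shows "C1_test (\<lambda>y t. - ((norm (a - y))\<^sup>2 / (2 * \<epsilon>) + (s - t)\<^sup>2 / (2 * \<epsilon>)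
                      + A * exp (- (k * t)) * (1 + (norm y)\<^sup>2) ^ Suc j))
     (\<lambda>y t. (a - y) /\<^sub>R \<epsilon> - (2 * real (Suc j) * (A * exp (- (k * t)) * (1 + (norm y)\<^sup>2) ^ j)) *\<^sub>R y)
     (\<lambda>y t. (s - t) / \<epsilon> + k * (A * exp (- (k * t)) * (1 + (norm y)\<^sup>2) ^ Suc j))"
  unfolding C1_test_def
proof (intro conjI allI)
  fix x :: "real^'i" and t :: real
  have 1: "((\<lambda>z. ((a - fst z) \<bullet> (a - fst z)) / (2 * \<epsilon>)) has_derivative
      (\<lambda>z. - (((a - x) /\<^sub>R \<epsilon>) \<bullet> fst z))) (at (x, t))"
    by (rule derivative_eq_intros refl assms | simp add: assms)+
       (simp add: assms fun_eq_iff inner_diff_left inner_diff_right inner_commute field_simps)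
  have 2: "((\<lambda>z. (s - snd z)\<^sup>2 / (2 * \<epsilon>)) has_derivative
      (\<lambda>z. - ((s - t) / \<epsilon> * snd z))) (at (x, t))"
    by (rule derivative_eq_intros refl assms | simp add: assms mult.commute)+
  have 3: "((\<lambda>z. A * exp (- (k * snd z)) * (1 + fst z \<bullet> fst z) ^ Suc j) has_derivative
      (\<lambda>z. (2 * real (Suc j) * (A * exp (- (k * t)) * (1 + x \<bullet> x) ^ j)) *\<^sub>R x \<bullet> fst z
        - k * (A * exp (- (k * t)) * (1 + x \<bullet> x) ^ Suc j) * snd z)) (at (x, t))"
    by (rule derivative_eq_intros refl | simp)+ (simp add: fun_eq_iff inner_commute algebra_simps)
  have "((\<lambda>z. - (((a - fst z) \<bullet> (a - fst z)) / (2 * \<epsilon>) + (s - snd z)\<^sup>2 / (2 * \<epsilon>)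
        + A * exp (- (k * snd z)) * (1 + fst z \<bullet> fst z) ^ Suc j)) has_derivative
      (\<lambda>z. ((a - x) /\<^sub>R \<epsilon> - (2 * real (Suc j) * (A * exp (- (k * t)) * (1 + x \<bullet> x) ^ j)) *\<^sub>R x) \<bullet> fst z
        + ((s - t) / \<epsilon> + k * (A * exp (- (k * t)) * (1 + x \<bullet> x) ^ Suc j)) * snd z)) (at (x, t))"
    by (rule has_derivative_eq_rhs[OF has_derivative_minus[OF has_derivative_add[OF has_derivative_add[OF 1 2] 3]]])
       (simp add: fun_eq_iff inner_diff_left distrib_right del: inner_scaleR_left power_Suc)
  then show "((\<lambda>(y, t). - ((norm (a - y))\<^sup>2 / (2 * \<epsilon>) + (s - t)\<^sup>2 / (2 * \<epsilon>)
                      + A * exp (- (k * t)) * (1 + (norm y)\<^sup>2) ^ Suc j)) has_derivative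
     (\<lambda>(h, ka). ((a - x) /\<^sub>R \<epsilon> - (2 * real (Suc j) * (A * exp (- (k * t)) * (1 + (norm x)\<^sup>2) ^ j)) *\<^sub>R x) \<bullet> h
        + ((s - t) / \<epsilon> + k * (A * exp (- (k * t)) * (1 + (norm x)\<^sup>2) ^ Suc j)) * ka)) (at (x, t))"
    by (simp only: case_prod_unfold power2_norm_eq_inner)
qed (auto simp: case_prod_unfold divide_inverse intro!: continuous_intros)

subsection \<open>Value iteration for a min-max game\<close>

lemma continuous_bounded_on_cball:
  fixes F :: "'v::euclidean_space \<Rightarrow> real"
  assumes "continuous_on UNIV F"
  obtains K where "\<And>v. norm v \<le> M \<Longrightarrow> \<bar>F v\<bar> \<le> K"
proof -
  have "bounded (F ` cball 0 M)"
    by (intro compact_imp_bounded compact_continuous_image continuous_on_subset[OF assms]) auto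
  then obtain K where "\<forall>v\<in>cball 0 M. \<bar>F v\<bar> \<le> K"
    by (auto simp: bounded_iff)
  then show ?thesis
    by (intro that[of K]) auto
qed

locale isaacs_game =
  fixes X :: "'q set" and Y :: "'w set" and f :: "'q \<Rightarrow> 'w \<Rightarrow> 'v::euclidean_space" and M :: real
  assumes X_nonempty: "X \<noteq> {}" and Y_nonempty: "Y \<noteq> {}"
    and norm_f_le: "\<And>q w. q \<in> X \<Longrightarrow> w \<in> Y \<Longrightarrow> norm (f q w) \<le> M"
begin

text \<open>The supremum is inside because an allocation sees the current observation before it
  answers.\<close>

definition minimax :: "('v \<Rightarrow> real) \<Rightarrow> real" where
  "minimax F = (INF q\<in>X. SUP w\<in>Y. F (f q w))"

primrec game_value :: "real \<Rightarrow> ('v \<Rightarrow> real) \<Rightarrow> nat \<Rightarrow> 'v \<Rightarrow> real" where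
  "game_value h g 0 = g"
| "game_value h g (Suc n) = (\<lambda>x. minimax (\<lambda>v. game_value h g n (x + h *\<^sub>R v)))"

lemma M_nonneg: "0 \<le> M"
  using X_nonempty Y_nonempty norm_f_le norm_ge_zero order_trans by (metis ex_in_conv)

lemma bdd_above_payoff:
  fixes F :: "'v \<Rightarrow> real"
  assumes "continuous_on UNIV F" "q \<in> X"
  shows "bdd_above ((\<lambda>w. F (f q w)) ` Y)"
proof -
  obtain K where "\<And>v. norm v \<le> M \<Longrightarrow> \<bar>F v\<bar> \<le> K"
    using continuous_bounded_on_cball[OF assms(1), of M] by blast
  then show ?thesis
    using norm_f_le[OF assms(2)] by (intro bdd_aboveI2[of _ _ K]) (auto simp: abs_le_iff)
qed

lemma bdd_below_sup_payoff:
  fixes F :: "'v \<Rightarrow> real"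
  assumes "continuous_on UNIV F"
  shows "bdd_below ((\<lambda>q. SUP w\<in>Y. F (f q w)) ` X)"
proof -
  obtain K where K: "\<And>v. norm v \<le> M \<Longrightarrow> \<bar>F v\<bar> \<le> K"
    using continuous_bounded_on_cball[OF assms(1), of M] by blast
  obtain w where w: "w \<in> Y" using Y_nonempty by auto
  have "- K \<le> (SUP w\<in>Y. F (f q w))" if "q \<in> X" for q
    using K[OF norm_f_le[OF that w]]
    by (intro cSUP_upper2[OF bdd_above_payoff w] assms that) auto
  then show ?thesis
    by (intro bdd_belowI2)
qed

lemma minimax_near_optimal:
  assumes "continuous_on UNIV F" "0 < e"
  obtains q where "q \<in> X" "\<And>w. w \<in> Y \<Longrightarrow> F (f q w) \<le> minimax F + e"
proof -
  have "\<exists>q\<in>X. (SUP w\<in>Y. F (f q w)) < minimax F + e"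
    using assms X_nonempty
    by (subst cINF_less_iff[symmetric]) (auto simp: minimax_def bdd_below_sup_payoff)
  then obtain q where q: "q \<in> X" "(SUP w\<in>Y. F (f q w)) < minimax F + e" by blast
  show thesis
  proof (rule that[OF q(1)])
    fix w assume "w \<in> Y"
    then have "F (f q w) \<le> (SUP w\<in>Y. F (f q w))"
      by (intro cSUP_upper bdd_above_payoff assms q)
    with q(2) show "F (f q w) \<le> minimax F + e" by simp
  qed
qed

lemma minimax_near_optimal_response:
  assumes "continuous_on UNIV F" "0 < e" "q \<in> X"
  shows "\<exists>w\<in>Y. minimax F - e \<le> F (f q w)"
proof -
  have "minimax F - e < (SUP w\<in>Y. F (f q w))"
    using cINF_lower[OF bdd_below_sup_payoff[OF assms(1)] assms(3)] assms(2)
    by (simp add: minimax_def)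
  then show ?thesis
    using less_cSUP_iff[OF Y_nonempty bdd_above_payoff[OF assms(1,3)]] by (meson less_imp_le)
qed

text \<open>Monotonicity, compatibility with constants and positive homogeneity of
  \<open>minimax\<close> packed into one affine inequality; the estimates on values below are
  instances of it.\<close>

lemma minimax_le:
  assumes "continuous_on UNIV F" "continuous_on UNIV G" "0 \<le> h"
    and le: "\<And>v. norm v \<le> M \<Longrightarrow> F v \<le> h * G v + c"
  shows "minimax F \<le> h * minimax G + c"
proof (rule field_le_epsilon)
  fix e :: real assume e: "0 < e"
  \<comment> \<open>Dividing by \<open>h + 1\<close> covers \<open>h = 0\<close> and still keeps
    \<open>h\<close> times the error below \<open>e\<close>.\<close>
  obtain q where q: "q \<in> X" "\<And>w. w \<in> Y \<Longrightarrow> G (f q w) \<le> minimax G + e / (h + 1)"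
    using minimax_near_optimal[OF assms(2), of "e / (h + 1)"] e assms(3) by auto
  have he: "h * (e / (h + 1)) \<le> e"
    using e assms(3) by (simp add: field_simps)
  have "minimax F \<le> (SUP w\<in>Y. F (f q w))"
    unfolding minimax_def using q by (intro cINF_lower bdd_below_sup_payoff assms)
  also have "\<dots> \<le> h * minimax G + c + e"
  proof (rule cSUP_least[OF Y_nonempty])
    fix w assume w: "w \<in> Y"
    have "F (f q w) \<le> h * G (f q w) + c" using le norm_f_le q(1) w by blast
    also have "\<dots> \<le> h * (minimax G + e / (h + 1)) + c"
      using q(2)[OF w] assms(3) by (simp add: mult_left_mono)
    also have "\<dots> \<le> h * minimax G + c + e" using he by (simp add: algebra_simps)
    finally show "F (f q w) \<le> h * minimax G + c + e" .
  qed
  finally show "minimax F \<le> h * minimax G + c + e" .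
qed

lemma minimax_ge:
  assumes "continuous_on UNIV F" "continuous_on UNIV G" "0 < h"
    and ge: "\<And>v. norm v \<le> M \<Longrightarrow> h * G v + c \<le> F v"
  shows "h * minimax G + c \<le> minimax F"
proof -
  have "minimax G \<le> (1 / h) * minimax F + (- c / h)"
    using assms by (intro minimax_le) (auto simp: field_simps)
  then show ?thesis using assms(3) by (simp add: field_simps)
qed

lemma minimax_const: "minimax (\<lambda>_. c) = c"
  using X_nonempty Y_nonempty by (simp add: minimax_def)

lemma continuous_on_inner_left: "continuous_on UNIV (\<lambda>v::'v. v \<bullet> p)"
  by (intro continuous_intros)

lemma minimax_inner_lipschitz:
  "minimax (\<lambda>v. v \<bullet> p) \<le> minimax (\<lambda>v. v \<bullet> q) + M * norm (p - q)"
proof -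
  have "v \<bullet> p \<le> 1 * (v \<bullet> q) + M * norm (p - q)" if "norm v \<le> M" for v
  proof -
    have "v \<bullet> (p - q) \<le> norm v * norm (p - q)" by (rule norm_cauchy_schwarz)
    also have "\<dots> \<le> M * norm (p - q)" using that by (simp add: mult_right_mono)
    finally show ?thesis by (simp add: inner_diff_right)
  qed
  from minimax_le[OF continuous_on_inner_left continuous_on_inner_left _ this] show ?thesis by simp
qed

text \<open>The state reached from 0 when \<open>r\<close> answers the history. The prefix
  \<open>take (Suc l) qs\<close> includes the current move, as in the objective, which is the
  coordinate of this vector for \<open>h = 1 / B\<close>.\<close>

definition trajectory :: "real \<Rightarrow> ('q list \<Rightarrow> 'w) \<Rightarrow> 'q list \<Rightarrow> 'v" where
  "trajectory h r qs = h *\<^sub>R (\<Sum>l<length qs. f (qs ! l) (r (take (Suc l) qs)))"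

lemma trajectory_Nil [simp]: "trajectory h r [] = 0"
  by (simp add: trajectory_def)

lemma trajectory_snoc [simp]:
  "trajectory h r (qs @ [q]) = trajectory h r qs + h *\<^sub>R f q (r (qs @ [q]))"
proof -
  have "(\<Sum>l<length qs. f ((qs @ [q]) ! l) (r (take (Suc l) (qs @ [q]))))
      = (\<Sum>l<length qs. f (qs ! l) (r (take (Suc l) qs)))"
    by (intro sum.cong) (auto simp: nth_append)
  then show ?thesis
    by (simp add: trajectory_def scaleR_add_right)
qed

section \<open>Regularity, consistency and near-optimal play for Lipschitz terminal data\<close>

context
  fixes h L :: real and g :: "'v \<Rightarrow> real"
  assumes h: "0 < h" and L: "0 \<le> L" and g: "\<And>x y. \<bar>g x - g y\<bar> \<le> L * norm (x - y)"
begin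

lemma continuous_on_of_lipschitz:
  fixes u :: "'v \<Rightarrow> real"
  assumes "\<And>x y. \<bar>u x - u y\<bar> \<le> L * norm (x - y)"
  shows "continuous_on UNIV u"
  using assms L by (intro lipschitz_on_continuous_on[of L] lipschitz_onI) (auto simp: dist_norm dist_real_def)

text \<open>Each round is monotone and commutes with adding constants, so it preserves the constant
  \<open>L\<close>, whatever \<open>n\<close> and \<open>h\<close> are.\<close>

lemma game_value_lipschitz:
  "\<bar>game_value h g n x - game_value h g n y\<bar> \<le> L * norm (x - y)"
proof (induction n arbitrary: x y)
  case (Suc n)
  have cont: "continuous_on UNIV (\<lambda>v. game_value h g n (x + h *\<^sub>R v))" for x
    by (rule continuous_on_compose2[OF continuous_on_of_lipschitz[OF Suc]]) (auto intro!: continuous_intros)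
  have *: "game_value h g (Suc n) x \<le> game_value h g (Suc n) y + L * norm (x - y)" for x y
  proof -
    have "game_value h g n (x + h *\<^sub>R v) \<le> 1 * game_value h g n (y + h *\<^sub>R v) + L * norm (x - y)" for v
      using Suc[of "x + h *\<^sub>R v" "y + h *\<^sub>R v"] by (auto simp: abs_le_iff)
    from minimax_le[OF cont cont _ this] show ?thesis by simp
  qed
  show ?case using *[of x y] *[of y x] by (simp add: abs_le_iff norm_minus_commute)
qed (use g in simp)

lemma continuous_on_game_value: "continuous_on UNIV (game_value h g n)"
  using continuous_on_of_lipschitz game_value_lipschitz .

lemma continuous_on_game_value_shift:
  "continuous_on UNIV (\<lambda>v. game_value h g n (x + h *\<^sub>R v))"
  by (rule continuous_on_compose2[OF continuous_on_game_value]) (auto intro!: continuous_intros)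

lemma game_value_step: "\<bar>game_value h g (Suc n) x - game_value h g n x\<bar> \<le> L * M * h"
proof -
  have *: "\<bar>game_value h g n (x + h *\<^sub>R v) - game_value h g n x\<bar> \<le> L * M * h" if "norm v \<le> M" for v
  proof -
    have "\<bar>game_value h g n (x + h *\<^sub>R v) - game_value h g n x\<bar> \<le> L * norm (h *\<^sub>R v)"
      using game_value_lipschitz[of n "x + h *\<^sub>R v" x] by simp
    also have "\<dots> \<le> L * (h * M)" using h L that by (intro mult_left_mono) auto
    finally show ?thesis by (simp add: mult_ac)
  qed
  have "game_value h g (Suc n) x \<le> 1 * minimax (\<lambda>_. game_value h g n x) + L * M * h"
    unfolding game_value.simps
    using * by (intro minimax_le continuous_on_game_value_shift) (auto simp: abs_le_iff algebra_simps)
  moreover have "1 * minimax (\<lambda>_. game_value h g n x) + - (L * M * h) \<le> game_value h g (Suc n) x"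
    unfolding game_value.simps
    using * by (intro minimax_ge continuous_on_game_value_shift) (fastforce simp: abs_le_iff algebra_simps)+
  ultimately show ?thesis by (simp add: minimax_const abs_le_iff)
qed

text \<open>One move displaces the state by at most \<open>h * M\<close>, which bounds the quadratic
  term; homogeneity turns the linear term into \<open>h\<close> times the Hamiltonian at
  \<open>p\<close>. The number \<open>c\<close> is free, which leaves room for the time
  penalty.\<close>

lemma game_value_consistent_upper:
  assumes "\<And>z. game_value h g n (x + z) \<le> c + p \<bullet> z + k * (norm z)\<^sup>2" "0 \<le> k"
  shows "game_value h g (Suc n) x \<le> c + h * minimax (\<lambda>v. v \<bullet> p) + k * (h * M)\<^sup>2"
proof -
  have "game_value h g n (x + h *\<^sub>R v) \<le> h * (v \<bullet> p) + (c + k * (h * M)\<^sup>2)" if "norm v \<le> M" for v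
  proof -
    have "k * (norm (h *\<^sub>R v))\<^sup>2 \<le> k * (h * M)\<^sup>2"
      using that h assms(2) by (intro mult_left_mono power_mono) auto
    then show ?thesis using assms(1)[of "h *\<^sub>R v"] by (simp add: inner_commute)
  qed
  from minimax_le[OF continuous_on_game_value_shift continuous_on_inner_left _ this] h show ?thesis
    by (simp add: algebra_simps)
qed

lemma game_value_consistent_lower:
  assumes "\<And>z. c + p \<bullet> z - k * (norm z)\<^sup>2 \<le> game_value h g n (x + z)" "0 \<le> k"
  shows "c + h * minimax (\<lambda>v. v \<bullet> p) - k * (h * M)\<^sup>2 \<le> game_value h g (Suc n) x"
proof -
  have "h * (v \<bullet> p) + (c - k * (h * M)\<^sup>2) \<le> game_value h g n (x + h *\<^sub>R v)" if "norm v \<le> M" for v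
  proof -
    have "k * (norm (h *\<^sub>R v))\<^sup>2 \<le> k * (h * M)\<^sup>2"
      using that h assms(2) by (intro mult_left_mono power_mono) auto
    then show ?thesis using assms(1)[of "h *\<^sub>R v"] by (simp add: inner_commute)
  qed
  from minimax_ge[OF continuous_on_game_value_shift continuous_on_inner_left h this] show ?thesis
    by (simp add: algebra_simps)
qed

text \<open>The minimiser plays against a known \<open>r\<close>: each \<open>q\<close> is
  near-optimal against all responses, hence against the one \<open>r\<close> will give. Infima need
  not be attained, so every round costs \<open>e\<close>.\<close>

lemma near_optimal_path:
  fixes e :: real
  assumes r: "\<And>qs. 1 \<le> length qs \<and> length qs \<le> B \<and> set qs \<subseteq> X \<Longrightarrow> r qs \<in> Y" and e: "0 < e"
  shows "l \<le> B \<Longrightarrow> \<exists>qs. length qs = l \<and> set qs \<subseteq> X \<and>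
    game_value h g (B - l) (trajectory h r qs) \<le> game_value h g B 0 + real l * e"
proof (induction l)
  case 0
  show ?case by (intro exI[of _ "[]"]) simp
next
  case (Suc l)
  then obtain qs where qs: "length qs = l" "set qs \<subseteq> X"
    "game_value h g (B - l) (trajectory h r qs) \<le> game_value h g B 0 + real l * e" by auto
  have Bl: "B - l = Suc (B - Suc l)" using Suc.prems by simp
  obtain q where q: "q \<in> X" "\<And>w. w \<in> Y \<Longrightarrow>
      game_value h g (B - Suc l) (trajectory h r qs + h *\<^sub>R f q w) \<le> game_value h g (B - l) (trajectory h r qs) + e"
    using minimax_near_optimal[OF continuous_on_game_value_shift[of "B - Suc l" "trajectory h r qs"] e]
    unfolding Bl game_value.simps by blast
  have "r (qs @ [q]) \<in> Y" using qs q Suc.prems by (intro r) auto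
  from q(2)[OF this] qs q(1) show ?case
    by (intro exI[of _ "qs @ [q]"]) (auto simp: algebra_simps)
qed

text \<open>The maximiser needs a single rule that is good on all paths at once, so near-optimal
  responses are chosen as a function of remaining rounds, state and observation.\<close>

lemma near_optimal_strategy:
  fixes e :: real
  assumes e: "0 < e"
  obtains r where "\<And>qs. qs \<noteq> [] \<Longrightarrow> set qs \<subseteq> X \<Longrightarrow> r qs \<in> Y"
    and "\<And>qs. set qs \<subseteq> X \<Longrightarrow> length qs \<le> B \<Longrightarrow>
      game_value h g B 0 - real (length qs) * e \<le> game_value h g (B - length qs) (trajectory h r qs)"
proof -
  have ex: "\<exists>w. q \<in> X \<longrightarrow> w \<in> Y \<and> game_value h g (Suc n) x - e \<le> game_value h g n (x + h *\<^sub>R f q w)" for n x q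
    using minimax_near_optimal_response[OF continuous_on_game_value_shift e, of q n x] by auto
  define w where "w n x q =
    (SOME w. q \<in> X \<longrightarrow> w \<in> Y \<and> game_value h g (Suc n) x - e \<le> game_value h g n (x + h *\<^sub>R f q w))" for n x q
  have w: "w n x q \<in> Y" "game_value h g (Suc n) x - e \<le> game_value h g n (x + h *\<^sub>R f q (w n x q))"
    if "q \<in> X" for n x q
    using someI_ex[OF ex[of q n x]] that unfolding w_def[symmetric] by auto
  \<comment> \<open>The strategy responds to the state reached so far; the state is recovered from the history
    by a recursion on the reversed list.\<close>
  define state where "state qs =
    rec_list 0 (\<lambda>q qs x. x + h *\<^sub>R f q (w (B - Suc (length qs)) x q)) (rev qs)" for qs
  have state: "state [] = 0"
    "state (qs @ [q]) = state qs + h *\<^sub>R f q (w (B - Suc (length qs)) (state qs) q)" for qs q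
    by (simp_all add: state_def)
  \<comment> \<open>The history includes the observation being answered: \<open>butlast qs\<close>
    gives the state before it, and \<open>B - length qs\<close> rounds remain after the
    answer.\<close>
  define r where "r qs = w (B - length qs) (state (butlast qs)) (last qs)" for qs
  have traj: "trajectory h r qs = state qs" for qs
    by (induction qs rule: rev_induct) (auto simp: state r_def)
  show thesis
  proof (rule that)
    fix qs assume "qs \<noteq> []" "set qs \<subseteq> X"
    then show "r qs \<in> Y" unfolding r_def using last_in_set[of qs] by (intro w(1)) blast
  next
    fix qs assume "set qs \<subseteq> X" "length qs \<le> B"
    then show "game_value h g B 0 - real (length qs) * e \<le> game_value h g (B - length qs) (trajectory h r qs)"
    proof (induction qs rule: rev_induct)
      case (snoc q qs)
      have "B - length qs = Suc (B - Suc (length qs))" using snoc.prems by simp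
      then show ?case
        using snoc w(2)[of q "B - Suc (length qs)" "state qs"]
        unfolding traj state by (auto simp: algebra_simps)
    qed simp
  qed
qed

end

end

subsection \<open>Comparison of the scheme with a supersolution\<close>

text \<open>A gap of \<open>5 * \<delta>\<close> at the origin is spent as follows:
  \<open>\<delta>\<close> each for moving \<open>U\<close> and \<open>V\<close> to a slightly later
  time, \<open>\<delta>\<close> for the penalty there, and the remaining \<open>2 * \<delta>\<close>
  exceeds what the common terminal data allow. The maximum of the doubled functional is therefore
  interior, where scheme and supersolution contradict each other.\<close>

theorem scheme_le_supersolution:
  fixes V :: "real^'i::finite \<Rightarrow> real \<Rightarrow> real" and U :: "nat \<Rightarrow> nat \<Rightarrow> real^'i \<Rightarrow> real"
  assumes H_lip: "\<And>p q. H p \<le> H q + M * norm (p - q)" and M: "0 \<le> M" and L: "0 \<le> L"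
    and contV: "continuous_on (UNIV \<times> {0..1}) (\<lambda>(x, t). V x t)"
    and V_terminal: "\<And>x. V x 1 = g x"
    and super: "viscosity_supersolution H V"
    and U_terminal: "\<And>B x. U B 0 x = g x"
    and U_lip: "\<And>B n x y. 0 < B \<Longrightarrow> \<bar>U B n x - U B n y\<bar> \<le> L * norm (x - y)"
    and U_step: "\<And>B n x. 0 < B \<Longrightarrow> \<bar>U B (Suc n) x - U B n x\<bar> \<le> L * M / B"
    and U_consistent: "\<And>B n x c p k. 0 < B \<Longrightarrow> 0 \<le> k \<Longrightarrow>
          (\<And>z. U B n (x + z) \<le> c + p \<bullet> z + k * (norm z)\<^sup>2) \<Longrightarrow>
          U B (Suc n) x \<le> c + H p / B + k * (M / B)\<^sup>2"
    and \<delta>: "0 < \<delta>"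
  shows "\<forall>\<^sub>F B in sequentially. U B B 0 < V 0 0 + 5 * \<delta>"
proof -
  \<comment> \<open>Chosen so that \<open>(1 + R\<^sup>2) ^ Suc j\<close> outweighs the time decay
    of the penalty on the side \<open>norm y = R\<close> up to time 1.\<close>
  define R where "R = sqrt (exp (M + 1))"
  have R: "0 \<le> R" "exp (M + 1) \<le> 1 + R\<^sup>2" by (auto simp: R_def)
  have compactC: "compact (cball (0::real^'i) R \<times> {0..1::real})"
    by (intro compact_Times) auto
  have contC: "continuous_on (cball (0::real^'i) R \<times> {0..1::real}) (\<lambda>(x, t). V x t)"
    by (rule continuous_on_subset[OF contV]) auto
  \<comment> \<open>For \<open>U\<close> the three summands are the spatial variation on the ball of
    radius \<open>R + 1\<close>, the drift accumulated over at most \<open>B\<close> rounds, and the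
    value at the origin.\<close>
  obtain K where K1: "1 \<le> K" and KU: "L * (R + 1) + L * M + \<bar>g 0\<bar> \<le> K"
    and KV: "\<And>y t. norm y \<le> R \<Longrightarrow> 0 \<le> t \<Longrightarrow> t \<le> 1 \<Longrightarrow> \<bar>V y t\<bar> \<le> K"
  proof -
    have "bounded ((\<lambda>(x, t). V x t) ` (cball 0 R \<times> {0..1}))"
      by (intro compact_imp_bounded compact_continuous_image contC compactC)
    then obtain a where "\<forall>z\<in>cball 0 R \<times> {0..1}. \<bar>case z of (x, t) \<Rightarrow> V x t\<bar> \<le> a"
      by (auto simp: bounded_iff)
    then have "\<forall>y\<in>cball 0 R. \<forall>t\<in>{0..1}. \<bar>V y t\<bar> \<le> a" by fastforce
    then show ?thesis
      by (intro that[of "max a (max 1 (L * (R + 1) + L * M + \<bar>g 0\<bar>))"]) (auto simp: le_max_iff_disj)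
  qed
  have U_steps: "\<bar>U B (n + k) x - U B n x\<bar> \<le> L * M * (k / B)" if "0 < B" for B n k x
  proof (induction k)
    case (Suc k)
    have "\<bar>U B (n + Suc k) x - U B n x\<bar> \<le> L * M / B + L * M * (k / B)"
      using Suc U_step[OF that, of "n + k" x] by simp
    also have "\<dots> = L * M * (Suc k / B)" by (simp add: algebra_simps add_divide_distrib)
    finally show ?case .
  qed simp
  have U_bound: "\<bar>U B n x\<bar> \<le> K" if "0 < B" "n \<le> B" "norm x \<le> R + 1" for B n x
  proof -
    have "L * M * (n / B) \<le> L * M * 1" using that L M by (intro mult_left_mono) auto
    moreover have "L * norm x \<le> L * (R + 1)" using that L by (intro mult_left_mono) auto
    ultimately show ?thesis
      using U_steps[OF that(1), of 0 n x] U_lip[OF that(1), of 0 x 0] KU U_terminal[of B]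
      by (simp add: abs_le_iff) linarith
  qed
  have modV: "\<exists>r>0. \<forall>y t y' t'. norm y \<le> R \<longrightarrow> norm y' \<le> R \<longrightarrow> 0 \<le> t \<longrightarrow> t \<le> 1 \<longrightarrow> 0 \<le> t' \<longrightarrow> t' \<le> 1 \<longrightarrow>
      dist (y, t) (y', t') < r \<longrightarrow> \<bar>V y t - V y' t'\<bar> < e" if "0 < e" for e
  proof -
    have "uniformly_continuous_on (cball 0 R \<times> {0..1}) (\<lambda>(x, t). V x t)"
      using compact_uniformly_continuous[OF contC compactC] .
    from this[unfolded uniformly_continuous_on_def, rule_format, OF that]
    show ?thesis by (fastforce simp: dist_real_def)
  qed
  obtain r where r: "0 < r" and Vr: "\<And>y t t'. norm y \<le> R \<Longrightarrow> 0 \<le> t \<Longrightarrow> t \<le> 1 \<Longrightarrow> 0 \<le> t' \<Longrightarrow> t' \<le> 1 \<Longrightarrow>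
      \<bar>t - t'\<bar> < r \<Longrightarrow> \<bar>V y t - V y t'\<bar> < \<delta>"
    using modV[OF \<delta>] by (fastforce simp: dist_Pair_Pair dist_real_def)
  \<comment> \<open>Times up to \<open>2 * \<tau>\<close> change \<open>U\<close> and
    \<open>V\<close> at the origin by at most \<open>\<delta>\<close>. The factor 2 leaves room to
    round \<open>\<tau>\<close> up to a grid time.\<close>
  define \<tau> where "\<tau> = min (r / 4) (min (1 / 2) (\<delta> / (2 * (L * M + 1))))"
  have LM: "0 \<le> L * M" using L M by simp
  have \<tau>: "0 < \<tau>" "2 * \<tau> < r" "2 * \<tau> \<le> 1" using r \<delta> LM by (auto simp: \<tau>_def)
  have \<tau>_LM: "L * M * (2 * \<tau>) \<le> \<delta>"
  proof -
    have "L * M * (2 * \<tau>) \<le> (L * M + 1) * (2 * (\<delta> / (2 * (L * M + 1))))"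
      using LM \<tau>(1) by (intro mult_mono) (auto simp: \<tau>_def)
    also have "\<dots> = \<delta>" using LM by (simp add: field_simps)
    finally show ?thesis .
  qed
  \<comment> \<open>With exponent \<open>N\<close>, the gradient of the penalty has norm at most
    \<open>N * \<psi>\<close> and its time derivative is \<open>- k * N * \<psi>\<close>; taking
    \<open>k = M + 1\<close> leaves the margin \<open>N * \<psi>\<close>. The height
    \<open>2 * K\<close> bounds \<open>U - V\<close>.\<close>
  define k where "k = M + 1"
  define A where "A = 2 * K"
  \<comment> \<open>The penalty \<open>\<psi>\<close> below satisfies \<open>\<partial>\<^sub>t\<psi> + M \<bar>\<nabla>\<psi>\<bar> < 0\<close>, dominates the gap between \<open>U\<close> and \<open>V\<close> both on
    \<open>\<bar>y\<bar> = R\<close> and at \<open>t = 0\<close>, and is at most \<open>\<delta>\<close> at \<open>(0, \<tau>)\<close> once the exponent \<open>Suc j\<close> is large.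
    It localises the comparison like a domain of dependence, \<open>V\<close> having no growth bound.\<close>
  have A: "0 < A" using K1 by (simp add: A_def)
  obtain j where j: "A * exp (- (k * real (Suc j) * \<tau>)) \<le> \<delta>"
  proof -
    have "(\<lambda>n. A * exp (- (k * \<tau>)) ^ n) \<longlonglongrightarrow> A * 0"
      using M \<tau>(1) by (intro tendsto_mult tendsto_const LIMSEQ_realpow_zero) (auto simp: k_def)
    then have "(\<lambda>n. A * exp (- (k * \<tau>)) ^ n) \<longlonglongrightarrow> 0" by simp
    from order_tendstoD(2)[OF this \<delta>] obtain N0 where
      "\<And>n. n \<ge> N0 \<Longrightarrow> A * exp (- (k * \<tau>)) ^ n < \<delta>" by (auto simp: eventually_sequentially)
    from this[of "Suc N0"] have "A * exp (real (Suc N0) * (- (k * \<tau>))) < \<delta>"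
      by (simp only: exp_of_nat_mult)
    then show ?thesis by (intro that[of N0]) (simp add: mult_ac)
  qed
  define N where "N = real (Suc j)"
  define \<psi> where "\<psi> = (\<lambda>(y::real^'i) t. A * exp (- (k * N * t)) * (1 + (norm y)\<^sup>2) ^ Suc j)"
  have \<psi>_pos: "0 < \<psi> y t" for y t
    using A by (auto simp: \<psi>_def intro!: mult_pos_pos zero_less_power add_pos_nonneg)
  have one_le: "1 \<le> (1 + (norm y)\<^sup>2) ^ Suc j" for y :: "real^'i"
    by (rule one_le_power) simp
  have \<psi>_init: "A \<le> \<psi> y 0" for y
    using A one_le[of y] by (simp add: \<psi>_def)
  have \<psi>_side: "A \<le> \<psi> y t" if "norm y = R" "0 \<le> t" "t \<le> 1" for y t
  proof -
    have "exp (k * N * t) \<le> exp (k * N)"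
      using that M by (auto simp: k_def N_def mult_left_le)
    also have "\<dots> = exp k ^ Suc j"
      unfolding N_def by (simp only: exp_of_nat_mult[symmetric] mult.commute)
    also have "\<dots> \<le> (1 + (norm y)\<^sup>2) ^ Suc j"
      using R that by (intro power_mono) (auto simp: k_def)
    finally have "exp (- (k * N * t)) * exp (k * N * t) \<le> exp (- (k * N * t)) * (1 + (norm y)\<^sup>2) ^ Suc j"
      by (rule mult_left_mono) simp
    then have "1 \<le> exp (- (k * N * t)) * (1 + (norm y)\<^sup>2) ^ Suc j"
      by (simp only: exp_add[symmetric]) simp
    then have "A * 1 \<le> A * (exp (- (k * N * t)) * (1 + (norm y)\<^sup>2) ^ Suc j)"
      using A by (intro mult_left_mono) auto
    then show ?thesis by (simp only: \<psi>_def mult.assoc mult_1_right)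
  qed
  \<comment> \<open>The least value of the margin \<open>N * \<psi>\<close>, reached at
    \<open>y = 0\<close> and \<open>t = 1\<close>.\<close>
  define \<eta> where "\<eta> = N * (A * exp (- (k * N)))"
  have \<eta>: "0 < \<eta>" using A by (simp add: \<eta>_def N_def)
  have \<psi>_\<eta>: "\<eta> \<le> N * \<psi> y t" if "t \<le> 1" for y t
  proof -
    have "A * exp (- (k * N)) * 1 \<le> \<psi> y t"
      unfolding \<psi>_def using that M A one_le[of y]
      by (intro mult_mono) (auto simp: k_def N_def mult_left_le)
    then show ?thesis by (auto simp: \<eta>_def N_def)
  qed
  \<comment> \<open>The distance allowed between the doubled variables, small enough that the
    terminal comparison costs less than \<open>2 * \<delta>\<close>.\<close>
  define \<sigma> where "\<sigma> = min (r / 2) (\<delta> / (2 * (L + L * M + 1)))"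
  have \<sigma>: "0 < \<sigma>" "\<sigma> < r" using r \<delta> L LM by (auto simp: \<sigma>_def)
  have \<sigma>_L: "L * \<sigma> + L * M * \<sigma> < \<delta>"
  proof -
    have "(L + L * M) * \<sigma> \<le> (L + L * M + 1) * (\<delta> / (2 * (L + L * M + 1)))"
      using L LM \<sigma>(1) by (intro mult_mono) (auto simp: \<sigma>_def)
    also have "\<dots> = \<delta> / 2" using L LM by (simp add: field_simps)
    finally show ?thesis using \<delta> by (simp add: algebra_simps)
  qed
  \<comment> \<open>The first bound forces the doubled variables within \<open>\<sigma>\<close>; the
    second makes the quadratic penalty beat the Lipschitz growth of \<open>U\<close> at distances at
    least 1.\<close>
  define \<epsilon> where "\<epsilon> = min (\<sigma>\<^sup>2 / (4 * K)) (1 / (2 * (L + 1)))"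
  have \<epsilon>: "0 < \<epsilon>" "4 * K * \<epsilon> \<le> \<sigma>\<^sup>2" "2 * L * \<epsilon> \<le> 1"
  proof -
    show "0 < \<epsilon>" using K1 L \<sigma> by (auto simp: \<epsilon>_def)
    have "\<epsilon> \<le> \<sigma>\<^sup>2 / (4 * K)" by (simp add: \<epsilon>_def)
    then show "4 * K * \<epsilon> \<le> \<sigma>\<^sup>2" using K1 by (simp add: field_simps)
    have "2 * L * \<epsilon> \<le> 2 * (L + 1) * (1 / (2 * (L + 1)))"
      using L \<open>0 < \<epsilon>\<close> by (intro mult_mono) (auto simp: \<epsilon>_def)
    then show "2 * L * \<epsilon> \<le> 1" using L by (simp split: if_splits)
  qed
  have small: "a \<le> \<sigma>" if "a\<^sup>2 / (2 * \<epsilon>) \<le> 2 * K" for a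
  proof (rule power2_le_imp_le)
    show "a\<^sup>2 \<le> \<sigma>\<^sup>2" using that \<epsilon> by (simp add: field_simps)
  qed (use \<sigma> in simp)
  \<comment> \<open>In \<open>M\<^sup>2 + 1\<close>, the first summand is the consistency error in
    space and the second comes from shifting the time penalty by one grid step.\<close>
  have "\<forall>\<^sub>F B in sequentially. 1 / real B < min \<tau> (\<eta> * (2 * \<epsilon>) / (M\<^sup>2 + 1))"
    using \<tau> \<eta> \<epsilon> by (intro order_tendstoD(2)[OF lim_1_over_n]) (auto intro!: divide_pos_pos add_nonneg_pos)
  moreover have "\<forall>\<^sub>F B in sequentially. 0 < B" by (rule eventually_gt_at_top)
  ultimately show ?thesis
  proof eventually_elim
    case (elim B)
    then have B: "0 < B" "1 / real B < \<tau>" and B\<eta>: "1 / real B < \<eta> * (2 * \<epsilon>) / (M\<^sup>2 + 1)" by auto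
    show ?case
    proof (rule ccontr)
      assume "\<not> U B B 0 < V 0 0 + 5 * \<delta>"
      then have contra: "V 0 0 + 5 * \<delta> \<le> U B B 0" by simp
      \<comment> \<open>The time at which \<open>n\<close> rounds remain.\<close>
      define T where "T = (\<lambda>n::nat. 1 - real n / real B)"
      define \<Phi> where "\<Phi> = (\<lambda>n x y t. U B n x - V y t - (norm (x - y))\<^sup>2 / (2 * \<epsilon>)
          - (T n - t)\<^sup>2 / (2 * \<epsilon>) - \<psi> y t)"
      define S where "S = cball (0::real^'i) (R + 1) \<times> cball (0::real^'i) R \<times> {0..1::real}"
      have "\<exists>z\<in>S. \<forall>z'\<in>S. (case z' of (x, y, t) \<Rightarrow> \<Phi> n x y t) \<le> (case z of (x, y, t) \<Rightarrow> \<Phi> n x y t)" for n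
      proof (rule continuous_attains_sup)
        show "compact S" unfolding S_def by (intro compact_Times) auto
        show "S \<noteq> {}" using R by (auto simp: S_def)
        have "continuous_on UNIV (U B n)"
          using U_lip[OF B(1)] L
          by (intro lipschitz_on_continuous_on[of L] lipschitz_onI) (auto simp: dist_norm dist_real_def)
        then have 1: "continuous_on S (\<lambda>z. U B n (fst z))"
          by (rule continuous_on_compose2) (auto intro!: continuous_intros)
        have 2: "continuous_on S (\<lambda>z. case snd z of (y, t) \<Rightarrow> V y t)"
          by (rule continuous_on_compose2[OF contV]) (auto simp: S_def intro!: continuous_intros)
        show "continuous_on S (\<lambda>z. case z of (x, y, t) \<Rightarrow> \<Phi> n x y t)"
          unfolding \<Phi>_def \<psi>_def using 1 2 \<epsilon>(1)
          by (auto simp: case_prod_unfold intro!: continuous_intros)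
      qed
      then obtain z where z: "\<And>n. z n \<in> S"
        "\<And>n z'. z' \<in> S \<Longrightarrow> (case z' of (x, y, t) \<Rightarrow> \<Phi> n x y t) \<le> (case z n of (x, y, t) \<Rightarrow> \<Phi> n x y t)"
        by metis
      define F where "F n = (case z n of (x, y, t) \<Rightarrow> \<Phi> n x y t)" for n
      have "Max (F ` {..B}) \<in> F ` {..B}" by (rule Max_in) auto
      then obtain n where "Max (F ` {..B}) = F n" "n \<in> {..B}" by (rule imageE)
      then have n: "n \<le> B" "Max (F ` {..B}) = F n" by simp_all
      have Fn: "F n' \<le> F n" if "n' \<le> B" for n'
        unfolding n(2)[symmetric] using that by (intro Max_ge) auto
      obtain x y t where zn: "z n = (x, y, t)" by (cases "z n")
      have xyt: "norm x \<le> R + 1" "norm y \<le> R" "0 \<le> t" "t \<le> 1"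
        using z(1)[of n] by (auto simp: zn S_def)
      have max1: "\<Phi> n' x' y' t' \<le> \<Phi> n x y t"
        if "n' \<le> B" "norm x' \<le> R + 1" "norm y' \<le> R" "0 \<le> t'" "t' \<le> 1" for n' x' y' t'
        using z(2)[of "(x', y', t')" n'] Fn[of n'] that by (simp add: S_def zn F_def)
      \<comment> \<open>Consistency asks for a bound at all displacements, so the maximality is
        extended to arbitrary \<open>x'\<close>: outside the ball, replacing \<open>x'\<close> by
        \<open>y'\<close> does not lower the functional.\<close>
      have max: "\<Phi> n' x' y' t' \<le> \<Phi> n x y t"
        if *: "n' \<le> B" "norm y' \<le> R" "0 \<le> t'" "t' \<le> 1" for n' x' y' t'
      proof (cases "norm x' \<le> R + 1")
        case False
        have d: "1 \<le> norm (x' - y')" using False * norm_triangle_ineq2[of x' y'] by linarith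
        have "L * norm (x' - y') * (2 * \<epsilon>) \<le> 1 * norm (x' - y')"
          using mult_right_mono[OF \<epsilon>(3), of "norm (x' - y')"] by (simp add: mult_ac)
        also have "\<dots> \<le> (norm (x' - y'))\<^sup>2"
          unfolding power2_eq_square using d by (intro mult_right_mono) auto
        finally have "L * norm (x' - y') \<le> (norm (x' - y'))\<^sup>2 / (2 * \<epsilon>)"
          using \<epsilon>(1) by (simp add: pos_le_divide_eq)
        then have "\<Phi> n' x' y' t' \<le> \<Phi> n' y' y' t'"
          using U_lip[OF B(1), of n' x' y'] by (simp add: \<Phi>_def abs_le_iff)
        also have "\<dots> \<le> \<Phi> n x y t" using * by (intro max1) auto
        finally show ?thesis .
      qed (use max1 * in auto)
      have lower: "2 * \<delta> \<le> \<Phi> n x y t"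
      proof -
        \<comment> \<open>The functional is evaluated at a grid time between \<open>\<tau>\<close>
          and \<open>2 * \<tau>\<close>, since at time 0 the penalty is as large as
          \<open>A\<close>.\<close>
        define l where "l = nat \<lceil>\<tau> * B\<rceil>"
        have l: "\<tau> * B \<le> l" "l < \<tau> * B + 1"
          using \<tau>(1) by (simp_all add: l_def) linarith+
        have "1 < \<tau> * B" using B by (simp add: field_simps)
        with l have "l < 2 * \<tau> * B" by simp
        also have "\<dots> \<le> 1 * real B" using \<tau>(3) by (intro mult_right_mono) auto
        finally have lB: "l \<le> B" by simp
        have tl: "\<tau> \<le> l / B" "l / B \<le> 2 * \<tau>"
          using l \<open>l < 2 * \<tau> * B\<close> B(1) by (simp_all add: field_simps)
        have Tl: "T (B - l) = l / B" using lB B(1) by (simp add: T_def of_nat_diff field_simps)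
        have "L * M * (l / B) \<le> \<delta>"
          using mult_left_mono[OF tl(2) LM] \<tau>_LM by simp
        then have 1: "U B B 0 - \<delta> \<le> U B (B - l) 0"
          using U_steps[OF B(1), of "B - l" l 0] lB by (simp add: abs_le_iff)
        have 2: "V 0 (l / B) \<le> V 0 0 + \<delta>"
          using Vr[of 0 "l / B" 0] R tl \<tau> by (simp add: abs_le_iff)
        have "A * exp (- (k * N * (l / B))) \<le> A * exp (- (k * N * \<tau>))"
          using A M tl(1) mult_left_mono[OF tl(1), of "k * N"] by (auto simp: k_def N_def)
        then have 3: "\<psi> 0 (l / B) \<le> \<delta>" using j by (simp add: \<psi>_def N_def)
        have "2 * \<delta> \<le> \<Phi> (B - l) 0 0 (l / B)"
          using 1 2 3 contra by (simp add: \<Phi>_def Tl)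
        also have "\<dots> \<le> \<Phi> n x y t" using R tl \<tau> by (intro max) auto
        finally show ?thesis .
      qed
      have UV: "U B n x - V y t \<le> 2 * K"
        using U_bound[OF B(1) n(1) xyt(1)] KV[OF xyt(2-4)] by (simp add: abs_le_iff)
      have nonneg: "0 \<le> (norm (x - y))\<^sup>2 / (2 * \<epsilon>)" "0 \<le> (T n - t)\<^sup>2 / (2 * \<epsilon>)"
        using \<epsilon>(1) by auto
      \<comment> \<open>A positive maximum forces the penalty below the gap \<open>U - V\<close>,
        hence below \<open>A\<close>; this excludes both the initial time and the side.\<close>
      have \<psi>_lt: "\<psi> y t < A" using lower UV nonneg \<delta> by (simp add: \<Phi>_def A_def)
      have t0: "0 < t" using \<psi>_lt \<psi>_init[of y] xyt(3) by (cases "t = 0") auto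
      have yR: "norm y < R" using \<psi>_lt \<psi>_side[of y t] xyt by (cases "norm y = R") auto
      have near: "norm (x - y) \<le> \<sigma>" "\<bar>T n - t\<bar> \<le> \<sigma>"
        using lower UV nonneg \<delta> \<psi>_pos[of y t] by (auto intro!: small simp: \<Phi>_def)
      have not_terminal: "\<not> (n = 0 \<or> t = 1)"
      proof
        assume "n = 0 \<or> t = 1"
        then have *: "n / B \<le> \<sigma>" "\<bar>t - 1\<bar> \<le> \<sigma>"
          using near(2) \<sigma> by (auto simp: T_def)
        have "L * M * (n / B) \<le> L * M * \<sigma>" using *(1) LM by (rule mult_left_mono)
        then have "U B n x \<le> g x + L * M * \<sigma>"
          using U_steps[OF B(1), of 0 n x] by (simp add: U_terminal abs_le_iff)
        moreover have "L * norm (x - y) \<le> L * \<sigma>" using near(1) L by (rule mult_left_mono)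
        then have "g x \<le> g y + L * \<sigma>"
          using U_lip[OF B(1), of 0 x y] by (simp add: U_terminal abs_le_iff)
        moreover have "g y - \<delta> \<le> V y t"
          using Vr[OF xyt(2-4), of 1] *(2) \<sigma>(2) by (simp add: V_terminal abs_le_iff)
        ultimately have "\<Phi> n x y t < 2 * \<delta>"
          using nonneg \<psi>_pos[of y t] \<sigma>_L by (simp add: \<Phi>_def)
        with lower show False by simp
      qed
      \<comment> \<open>Maximality against \<open>n'\<close>, one round later in time, gives a
        quadratic upper bound for \<open>U B n'\<close> around \<open>x\<close>, to which
        consistency applies.\<close>
      then obtain n' where n': "n = Suc n'" by (cases n) auto
      have t1: "t < 1" using not_terminal xyt(4) by simp
      define h where "h = 1 / real B"
      have h: "0 < h" using B by (simp add: h_def)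
      define p where "p = (x - y) /\<^sub>R \<epsilon>"
      define q where "q = (T n - t) / \<epsilon>"
      have Tn': "T n' = T n + h" by (simp add: n' T_def h_def add_divide_distrib)
      have scheme: "0 \<le> q + H p + h * (M\<^sup>2 + 1) / (2 * \<epsilon>)"
      proof -
        have "U B n' (x + w) \<le> (U B n x + h * q + h\<^sup>2 / (2 * \<epsilon>)) + p \<bullet> w + (1 / (2 * \<epsilon>)) * (norm w)\<^sup>2" for w
        proof -
          have a: "(norm (x + w - y))\<^sup>2 / (2 * \<epsilon>) = (norm (x - y))\<^sup>2 / (2 * \<epsilon>) + p \<bullet> w + (1 / (2 * \<epsilon>)) * (norm w)\<^sup>2"
            using \<epsilon>(1) unfolding power2_norm_eq_inner p_def
            by (simp add: inner_simps inner_commute field_simps)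
          have b: "(T n' - t)\<^sup>2 / (2 * \<epsilon>) = (T n - t)\<^sup>2 / (2 * \<epsilon>) + h * q + h\<^sup>2 / (2 * \<epsilon>)"
            using \<epsilon>(1) by (simp add: Tn' q_def power2_eq_square field_simps)
          have "\<Phi> n' (x + w) y t \<le> \<Phi> n x y t" using n(1) n' xyt by (intro max) auto
          then show ?thesis using a b by (simp add: \<Phi>_def)
        qed
        from U_consistent[OF B(1) _ this] \<epsilon>(1)
        have "U B n x \<le> (U B n x + h * q + h\<^sup>2 / (2 * \<epsilon>)) + h * H p + (1 / (2 * \<epsilon>)) * (h * M)\<^sup>2"
          by (simp add: n' h_def)
        then have "0 \<le> h * (q + H p + h * (M\<^sup>2 + 1) / (2 * \<epsilon>))"
          using \<epsilon>(1) by (simp add: power2_eq_square field_simps)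
        then show ?thesis using h by (simp add: zero_le_mult_iff)
      qed
      have \<epsilon>_nz: "\<epsilon> \<noteq> 0" using \<epsilon>(1) by simp
      define D where "D = (2 * N * (A * exp (- (k * N * t)) * (1 + (norm y)\<^sup>2) ^ j)) *\<^sub>R y"
      \<comment> \<open>With \<open>n\<close> and \<open>x\<close> frozen, maximality says that
        \<open>V - \<phi>\<close> has a local minimum at the interior point \<open>(y, t)\<close>;
        \<open>e\<close> keeps its neighbours inside the cylinder where maximality is
        available.\<close>
      have "q + k * N * \<psi> y t + H (p - D) \<le> 0"
      proof -
        define \<phi> where "\<phi> = (\<lambda>y t. - ((norm (x - y))\<^sup>2 / (2 * \<epsilon>) + (T n - t)\<^sup>2 / (2 * \<epsilon>) + \<psi> y t))"
        define e where "e = min (R - norm y) (min t (1 - t))"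
        have "0 < e" using yR t0 t1 by (simp add: e_def)
        moreover have "V y t - \<phi> y t \<le> V y' t' - \<phi> y' t'" if "dist (y', t') (y, t) < e" for y' t'
        proof -
          have "dist y' y < e" "dist t' t < e"
            using that dist_fst_le[of "(y', t')" "(y, t)"] dist_snd_le[of "(y', t')" "(y, t)"] by auto
          then have "norm (y' - y) < R - norm y" "\<bar>t' - t\<bar> < t" "\<bar>t' - t\<bar> < 1 - t"
            by (auto simp: e_def dist_norm)
          then have "norm y' \<le> R" "0 \<le> t'" "t' \<le> 1"
            using norm_triangle_ineq2[of y' y] by auto
          from max[OF n(1) this, of x] show ?thesis by (simp add: \<Phi>_def \<phi>_def)
        qed
        ultimately have "\<exists>e>0. \<forall>y' t'. dist (y', t') (y, t) < e \<longrightarrow> V y t - \<phi> y t \<le> V y' t' - \<phi> y' t'"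
          by blast
        with super[unfolded viscosity_supersolution_def, rule_format,
            OF conjI, OF C1_test_doubling[OF \<epsilon>_nz, of x "T n" A "k * N" j], of t y] t0 t1
        show ?thesis
          by (simp add: \<phi>_def \<psi>_def p_def q_def D_def N_def)
      qed
      moreover have "norm D \<le> N * \<psi> y t"
      proof -
        have "2 * norm y \<le> 1 + (norm y)\<^sup>2"
          using sum_squares_bound[of "norm y" 1] by simp
        moreover define c where "c = A * exp (- (k * N * t)) * (1 + (norm y)\<^sup>2) ^ j"
        have c: "0 \<le> c" using A by (simp add: c_def)
        moreover have N: "0 \<le> N" by (simp add: N_def)
        ultimately have "N * c * (2 * norm y) \<le> N * c * (1 + (norm y)\<^sup>2)"
          by (intro mult_left_mono) auto
        moreover have "norm D = N * c * (2 * norm y)"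
          using c N by (simp add: D_def c_def[symmetric] abs_mult)
        moreover have "\<psi> y t = c * (1 + (norm y)\<^sup>2)" by (simp add: \<psi>_def c_def)
        ultimately show ?thesis by (simp add: mult.assoc)
      qed
      then have "M * norm D \<le> M * (N * \<psi> y t)" using M by (rule mult_left_mono)
      moreover have "H p \<le> H (p - D) + M * norm D" using H_lip[of p "p - D"] by simp
      \<comment> \<open>Replacing \<open>p - D\<close> by \<open>p\<close> costs
        \<open>M * N * \<psi>\<close>, and \<open>k = M + 1\<close> leaves one copy of
        \<open>N * \<psi>\<close>. The terms \<open>q + H p\<close> are common to both inequalities
        and cancel.\<close>
      ultimately have "q + N * \<psi> y t + H p \<le> 0" by (simp add: k_def algebra_simps)
      with scheme \<psi>_\<eta>[OF xyt(4), of y] have "\<eta> \<le> h * (M\<^sup>2 + 1) / (2 * \<epsilon>)" by simp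
      moreover have "h * (M\<^sup>2 + 1) / (2 * \<epsilon>) < \<eta>"
        using B\<eta> \<epsilon>(1) unfolding h_def[symmetric]
        by (subst (asm) pos_less_divide_eq) (auto simp: pos_divide_less_eq intro!: add_nonneg_pos)
      ultimately show False by simp
    qed
  qed
qed

subsection \<open>The bandit game\<close>

text \<open>Whatever index \<open>j\<close> a decision rule declares, some rejected index has score
  at most \<open>gterm x\<close>; a second index must exist for the minimum to be over a nonempty
  set.\<close>

lemma gterm_ge_other_coordinate:
  fixes x :: "real^'i::finite"
  assumes "CARD('i) \<ge> 2"
  shows "\<exists>i. i \<noteq> j \<and> x $ i \<le> gterm x"
proof -
  have "UNIV \<noteq> {j}" using assms by (auto dest!: arg_cong[of _ _ card])
  then have "{x $ i | i. i \<noteq> j} \<noteq> {}" by auto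
  then have "Min {x $ i | i. i \<noteq> j} \<in> {x $ i | i. i \<noteq> j}" by (intro Min_in) auto
  moreover have "Min {x $ i | i. i \<noteq> j} \<le> gterm x" unfolding gterm_def by (intro Max_ge) auto
  ultimately show ?thesis by auto
qed

text \<open>The maximising \<open>j\<close> in \<open>gterm\<close> serves as the optimal decision
  at final state \<open>x\<close>.\<close>

lemma gterm_le_other_coordinates:
  fixes x :: "real^'i::finite"
  shows "\<exists>j. \<forall>i. i \<noteq> j \<longrightarrow> gterm x \<le> x $ i"
proof -
  have "gterm x \<in> range (\<lambda>j. Min {x $ i | i. i \<noteq> j})" unfolding gterm_def by (intro Max_in) auto
  then obtain j where "gterm x = Min {x $ i | i. i \<noteq> j}" by auto
  then show ?thesis by (intro exI[of _ j]) (auto intro!: Min_le)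
qed

lemma gterm_lipschitz:
  fixes x y :: "real^'i::finite"
  assumes "CARD('i) \<ge> 2"
  shows "\<bar>gterm x - gterm y\<bar> \<le> 1 * norm (x - y)"
proof -
  have *: "gterm x \<le> gterm y + norm (x - y)" for x y :: "real^'i"
  proof -
    obtain j where j: "\<And>i. i \<noteq> j \<Longrightarrow> gterm x \<le> x $ i" using gterm_le_other_coordinates by blast
    obtain i where "i \<noteq> j" "y $ i \<le> gterm y" using gterm_ge_other_coordinate[OF assms] by blast
    with j[of i] component_le_norm_cart[of "x - y" i] show ?thesis by simp
  qed
  from *[of x y] *[of y x] show ?thesis by (simp add: abs_le_iff norm_minus_commute)
qed

lemma uniform_in_prob_simplex: "(\<lambda>_. 1 / CARD('b)) \<in> (prob_simplex :: ('b::finite \<Rightarrow> real) set)"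
  by (simp add: prob_simplex_def)

lemma prob_simplex_le_1: "p \<in> prob_simplex \<Longrightarrow> p b \<le> 1"
  using member_le_sum[of b UNIV p] by (auto simp: prob_simplex_def)

text \<open>Termwise, \<open>q ln q\<close> lies in \<open>[-1, 0]\<close> by
  \<open>ln z \<le> z - 1\<close> at \<open>z = 1 / q\<close>, and \<open>- q ln p\<close> lies
  between 0 and \<open>- ln \<epsilon>\<close>.\<close>

lemma abs_KL_le:
  fixes q p :: "'x::finite \<Rightarrow> real"
  assumes q: "q \<in> prob_simplex" and p: "p \<in> prob_simplex" and \<epsilon>: "0 < \<epsilon>" "\<And>x. \<epsilon> \<le> p x"
  shows "\<bar>KL q p\<bar> \<le> CARD('x) * (1 - ln \<epsilon>)"
proof -
  have "\<bar>if q x = 0 then 0 else q x * ln (q x / p x)\<bar> \<le> 1 - ln \<epsilon>" for x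
  proof -
    have px: "\<epsilon> \<le> p x" "p x \<le> 1" using p \<epsilon> prob_simplex_le_1 by auto
    have \<epsilon>1: "ln \<epsilon> \<le> ln (p x)" "ln (p x) \<le> 0" using \<epsilon>(1) px by (auto simp: ln_mono)
    show ?thesis
    proof (cases "q x = 0")
      case False
      then have qx: "0 < q x" "q x \<le> 1"
        using q prob_simplex_le_1[OF q] by (auto simp: prob_simplex_def order_less_le)
      have "- ln (q x) \<le> 1 / q x - 1"
        using ln_le_minus_one[of "1 / q x"] qx by (simp add: ln_div)
      then have "q x * - ln (q x) \<le> q x * (1 / q x - 1)" using qx by (intro mult_left_mono) auto
      also have "\<dots> \<le> 1" using qx by (simp add: field_simps)
      finally have 1: "- (q x * ln (q x)) \<le> 1" by simp
      have 2: "q x * ln (q x) \<le> 0" using qx by (simp add: mult_nonneg_nonpos)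
      have 3: "q x * - ln (p x) \<le> 1 * - ln \<epsilon>" using qx \<epsilon>1 by (intro mult_mono) auto
      have 4: "q x * ln (p x) \<le> 0" using qx \<epsilon>1 by (simp add: mult_nonneg_nonpos)
      have "q x * ln (q x / p x) = q x * ln (q x) - q x * ln (p x)"
        using qx px \<epsilon>(1) by (simp add: ln_div algebra_simps)
      then show ?thesis using False 1 2 3 4 by (simp add: abs_le_iff)
    qed (use \<epsilon>1 in simp)
  qed
  then have "(\<Sum>x\<in>UNIV. \<bar>if q x = 0 then 0 else q x * ln (q x / p x)\<bar>) \<le> (\<Sum>x::'x\<in>UNIV. 1 - ln \<epsilon>)"
    by (intro sum_mono)
  moreover have "\<bar>KL q p\<bar> \<le> (\<Sum>x\<in>UNIV. \<bar>if q x = 0 then 0 else q x * ln (q x / p x)\<bar>)"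
    unfolding KL_def by (rule sum_abs)
  ultimately show ?thesis by simp
qed

definition divergence_drift ::
  "('i::finite \<Rightarrow> 'a::finite \<Rightarrow> 'x::finite \<Rightarrow> real) \<Rightarrow> ('a \<Rightarrow> 'x \<Rightarrow> real) \<Rightarrow> ('a \<Rightarrow> real) \<Rightarrow> real^'i" where
  "divergence_drift \<nu> Q w = (\<chi> i. \<Sum>a\<in>UNIV. w a * KL (Q a) (\<nu> i a))"

lemma isaacs_game_divergence_drift:
  fixes \<nu> :: "'i::finite \<Rightarrow> 'a::finite \<Rightarrow> 'x::finite \<Rightarrow> real"
  assumes \<nu>: "\<And>i a. \<nu> i a \<in> prob_simplex" and \<epsilon>: "0 < \<epsilon>" "\<And>i a x. \<epsilon> \<le> \<nu> i a x"
  shows "isaacs_game obs_profile prob_simplex (divergence_drift \<nu>) (CARD('i) * (CARD('x) * (1 - ln \<epsilon>)))"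
proof
  have "(\<lambda>_ _. 1 / CARD('x)) \<in> (obs_profile :: ('a \<Rightarrow> 'x \<Rightarrow> real) set)"
    by (simp add: obs_profile_def uniform_in_prob_simplex)
  then show "(obs_profile :: ('a \<Rightarrow> 'x \<Rightarrow> real) set) \<noteq> {}" by blast
  show "(prob_simplex :: ('a \<Rightarrow> real) set) \<noteq> {}" using uniform_in_prob_simplex by blast
  fix Q :: "'a \<Rightarrow> 'x \<Rightarrow> real" and w :: "'a \<Rightarrow> real"
  assume Q: "Q \<in> obs_profile" and w: "w \<in> prob_simplex"
  let ?C = "CARD('x) * (1 - ln \<epsilon>)"
  have "\<bar>divergence_drift \<nu> Q w $ i\<bar> \<le> ?C" for i
  proof -
    have "\<bar>divergence_drift \<nu> Q w $ i\<bar> \<le> (\<Sum>a\<in>UNIV. \<bar>w a * KL (Q a) (\<nu> i a)\<bar>)"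
      by (simp add: divergence_drift_def)
    also have "\<dots> \<le> (\<Sum>a\<in>UNIV. w a * ?C)"
    proof (intro sum_mono)
      fix a
      have "\<bar>KL (Q a) (\<nu> i a)\<bar> \<le> ?C"
        using Q by (intro abs_KL_le \<nu> \<epsilon>) (auto simp: obs_profile_def)
      then show "\<bar>w a * KL (Q a) (\<nu> i a)\<bar> \<le> w a * ?C"
        using w by (auto simp: abs_mult prob_simplex_def intro!: mult_left_mono)
    qed
    also have "\<dots> = ?C" using w by (simp add: sum_distrib_right[symmetric] prob_simplex_def)
    finally show ?thesis .
  qed
  then have "(\<Sum>i\<in>UNIV. \<bar>divergence_drift \<nu> Q w $ i\<bar>) \<le> (\<Sum>i::'i\<in>UNIV. ?C)" by (intro sum_mono)
  then show "norm (divergence_drift \<nu> Q w) \<le> CARD('i) * ?C"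
    using norm_le_l1_cart[of "divergence_drift \<nu> Q w"] by simp
qed

lemma Ham_eq_minimax:
  assumes "isaacs_game obs_profile prob_simplex (divergence_drift \<nu>) M"
  shows "Ham \<nu> p = isaacs_game.minimax obs_profile prob_simplex (divergence_drift \<nu>) (\<lambda>v. v \<bullet> p)"
proof -
  have "(\<Sum>i\<in>UNIV. \<Sum>a\<in>UNIV. w a * KL (Q a) (\<nu> i a) * p $ i) = divergence_drift \<nu> Q w \<bullet> p" for Q w
    by (simp add: divergence_drift_def inner_vec_def sum_distrib_right)
  then show ?thesis
    by (simp add: Ham_def isaacs_game.minimax_def[OF assms] setcompr_eq_image)
qed

text \<open>Both near-optimal plays are run with loss \<open>e / B\<close> per round, hence
  \<open>e\<close> in total. The decision rule acts only on the final state, where the two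
  coordinate lemmas for \<open>gterm\<close> settle its effect.\<close>

lemma R_go_eq_game_value:
  fixes \<nu> :: "'i::finite \<Rightarrow> 'a::finite \<Rightarrow> 'x::finite \<Rightarrow> real"
  assumes card: "CARD('i) \<ge> 2" and game: "isaacs_game obs_profile prob_simplex (divergence_drift \<nu>) M"
    and B: "0 < B"
  shows "R_go \<nu> B =
    isaacs_game.game_value obs_profile prob_simplex (divergence_drift \<nu>) (1 / B) gterm B 0"
proof -
  interpret isaacs_game obs_profile prob_simplex "divergence_drift \<nu>" M by (rule game)
  let ?v = "game_value (1 / B) gterm B 0"
  let ?I = "\<lambda>r J. Inf {Min {objective \<nu> B r Qs i | i. i \<noteq> J Qs} | Qs. Qs \<in> paths B}"
  have h: "0 < 1 / real B" using B by simp
  note lip = gterm_lipschitz[OF card]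
  have obj: "objective \<nu> B r Qs i = trajectory (1 / B) r Qs $ i" if "Qs \<in> paths B" for r Qs i
    using that by (simp add: objective_def trajectory_def paths_def divergence_drift_def)
  have finite: "finite {objective \<nu> B r Qs i | i. i \<noteq> j}" for r Qs j by simp
  have nonempty: "{objective \<nu> B r Qs i | i. i \<noteq> j} \<noteq> {}" for r Qs j
    using gterm_ge_other_coordinate[OF card, of j] by blast
  \<comment> \<open>A bound from below over all paths is required before the real infimum can be
    compared with its members.\<close>
  have obj_bound: "- M \<le> objective \<nu> B r Qs i" if "alloc_rule B r" "Qs \<in> paths B" for r Qs i
  proof -
    have "norm (\<Sum>l<length Qs. divergence_drift \<nu> (Qs ! l) (r (take (Suc l) Qs))) \<le> of_nat (card {..<length Qs}) * M"
    proof (rule sum_norm_bound)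
      fix l assume l: "l \<in> {..<length Qs}"
      have "set (take (Suc l) Qs) \<subseteq> obs_profile"
        using that(2) set_take_subset[of "Suc l" Qs] by (auto simp: paths_def)
      then have "r (take (Suc l) Qs) \<in> prob_simplex"
        using that l by (auto simp: alloc_rule_def paths_def)
      moreover have "Qs ! l \<in> obs_profile" using that(2) l by (auto simp: paths_def)
      ultimately show "norm (divergence_drift \<nu> (Qs ! l) (r (take (Suc l) Qs))) \<le> M"
        by (intro norm_f_le)
    qed
    then have "norm (trajectory (1 / B) r Qs) \<le> M"
      using that(2) B by (simp add: trajectory_def paths_def field_simps)
    then show ?thesis
      using component_le_norm_cart[of "trajectory (1 / B) r Qs" i] by (simp add: obj[OF that(2)])
  qed
  have upper: "?I r J \<le> ?v" if r: "alloc_rule B r" for r J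
  proof (rule field_le_epsilon)
    fix e :: real assume e: "0 < e"
    have "\<exists>qs. length qs = B \<and> set qs \<subseteq> obs_profile \<and>
        game_value (1 / B) gterm (B - B) (trajectory (1 / B) r qs) \<le> ?v + real B * (e / B)"
      by (rule near_optimal_path[OF h _ lip]) (use r e B in \<open>auto simp: alloc_rule_def\<close>)
    then obtain Qs where Qs: "Qs \<in> paths B" "gterm (trajectory (1 / B) r Qs) \<le> ?v + e"
      using e B by (auto simp: paths_def)
    obtain i where i: "i \<noteq> J Qs" "trajectory (1 / B) r Qs $ i \<le> gterm (trajectory (1 / B) r Qs)"
      using gterm_ge_other_coordinate[OF card] by blast
    have "?I r J \<le> Min {objective \<nu> B r Qs i | i. i \<noteq> J Qs}"
    proof (rule cInf_lower)
      show "bdd_below {Min {objective \<nu> B r Qs i | i. i \<noteq> J Qs} | Qs. Qs \<in> paths B}"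
      proof (rule bdd_belowI)
        fix m assume "m \<in> {Min {objective \<nu> B r Qs i | i. i \<noteq> J Qs} | Qs. Qs \<in> paths B}"
        then obtain Qs where Qs: "Qs \<in> paths B" "m = Min {objective \<nu> B r Qs i | i. i \<noteq> J Qs}" by blast
        show "- M \<le> m"
          unfolding Qs(2) Min_ge_iff[OF finite nonempty] using obj_bound[OF r Qs(1)] by blast
      qed
    qed (use Qs in blast)
    also have "\<dots> \<le> objective \<nu> B r Qs i" using i by (intro Min_le finite) auto
    also have "\<dots> \<le> ?v + e" using i Qs by (simp add: obj)
    finally show "?I r J \<le> ?v + e" .
  qed
  have lower: "\<exists>r J. alloc_rule B r \<and> ?v - e \<le> ?I r J" if e: "0 < e" for e
  proof -
    obtain r where r: "\<And>qs. qs \<noteq> [] \<Longrightarrow> set qs \<subseteq> obs_profile \<Longrightarrow> r qs \<in> prob_simplex"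
      "\<And>qs. set qs \<subseteq> obs_profile \<Longrightarrow> length qs \<le> B \<Longrightarrow>
      ?v - length qs * (e / B) \<le> game_value (1 / B) gterm (B - length qs) (trajectory (1 / B) r qs)"
      using near_optimal_strategy[OF h _ lip, of "e / B" B] e B by auto
    have "\<forall>Qs. \<exists>j. \<forall>i. i \<noteq> j \<longrightarrow> gterm (trajectory (1 / B) r Qs) \<le> trajectory (1 / B) r Qs $ i"
      using gterm_le_other_coordinates by blast
    from choice[OF this] obtain J where
      J: "\<And>Qs i. i \<noteq> J Qs \<Longrightarrow> gterm (trajectory (1 / B) r Qs) \<le> trajectory (1 / B) r Qs $ i"
      by blast
    have "alloc_rule B r" by (auto simp: alloc_rule_def intro!: r(1))
    moreover have "?v - e \<le> ?I r J"
    proof (rule cInf_greatest)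
      obtain Q :: "'a \<Rightarrow> 'x \<Rightarrow> real" where "Q \<in> obs_profile" using X_nonempty by auto
      then have "replicate B Q \<in> paths B" by (auto simp: paths_def)
      then show "{Min {objective \<nu> B r Qs i | i. i \<noteq> J Qs} | Qs. Qs \<in> paths B} \<noteq> {}" by blast
      fix m assume "m \<in> {Min {objective \<nu> B r Qs i | i. i \<noteq> J Qs} | Qs. Qs \<in> paths B}"
      then obtain Qs where Qs: "Qs \<in> paths B" and m: "m = Min {objective \<nu> B r Qs i | i. i \<noteq> J Qs}" by blast
      have "?v - e \<le> gterm (trajectory (1 / B) r Qs)"
        using r(2)[of Qs] Qs B by (simp add: paths_def)
      then have "?v - e \<le> objective \<nu> B r Qs i" if "i \<noteq> J Qs" for i
        using J[OF that] by (simp add: obj[OF Qs])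
      then show "?v - e \<le> m"
        unfolding m Min_ge_iff[OF finite nonempty] by blast
    qed
    ultimately show ?thesis by blast
  qed
  show ?thesis
  proof (rule antisym)
    obtain r J where "alloc_rule B r" "?v - 1 \<le> ?I r J" using lower[of 1] by auto
    then show "R_go \<nu> B \<le> ?v"
      unfolding R_go_def using upper by (intro cSup_least) blast+
    show "?v \<le> R_go \<nu> B"
    proof (rule field_le_epsilon)
      fix e :: real assume "0 < e"
      then obtain r J where rJ: "alloc_rule B r" "?v - e \<le> ?I r J" using lower by blast
      have "?I r J \<le> R_go \<nu> B"
        unfolding R_go_def
      proof (rule cSup_upper)
        show "bdd_above {?I r J | r J. alloc_rule B r}"
          using upper by (intro bdd_aboveI[of _ ?v]) auto
      qed (use rJ in blast)
      with rJ show "?v \<le> R_go \<nu> B + e" by simp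
    qed
  qed
qed

theorem mainTheorem3:
  fixes \<nu> :: "'i::finite \<Rightarrow> 'a::finite \<Rightarrow> 'x::finite \<Rightarrow> real"
    and V :: "real^'i \<Rightarrow> real \<Rightarrow> real"
  assumes "CARD('i) \<ge> 2"
    and "\<forall>i a. \<nu> i a \<in> prob_simplex"
    and "\<exists>\<epsilon>>0. \<forall>i a x. \<epsilon> \<le> \<nu> i a x"
    and "viscosity_solution (Ham \<nu>) gterm V"
  shows "(\<lambda>B. R_go \<nu> B) \<longlonglongrightarrow> V 0 0"
proof -
  obtain \<epsilon> where \<epsilon>: "0 < \<epsilon>" "\<And>i a x. \<epsilon> \<le> \<nu> i a x" using assms(3) by blast
  define M where "M = CARD('i) * (CARD('x) * (1 - ln \<epsilon>))"
  have game: "isaacs_game obs_profile prob_simplex (divergence_drift \<nu>) M"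
    unfolding M_def using assms(2) \<epsilon> by (intro isaacs_game_divergence_drift) auto
  interpret isaacs_game obs_profile prob_simplex "divergence_drift \<nu>" M by (rule game)
  note lip = gterm_lipschitz[OF assms(1)]
  define U where "U = (\<lambda>B::nat. game_value (1 / B) gterm)"
  have H: "Ham \<nu> p \<le> Ham \<nu> q + M * norm (p - q)" for p q
    unfolding Ham_eq_minimax[OF game] by (rule minimax_inner_lipschitz)
  have V: "continuous_on (UNIV \<times> {0..1}) (\<lambda>(x, t). V x t)" "V x 1 = gterm x" for x
    using assms(4) by (auto simp: viscosity_solution_def)
  have U0: "U B 0 x = gterm x" for B x by (simp add: U_def)
  have Ulip: "\<bar>U B n x - U B n y\<bar> \<le> 1 * norm (x - y)" if "0 < B" for B n x y
    unfolding U_def using that by (intro game_value_lipschitz lip) auto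
  have Ustep: "\<bar>U B (Suc n) x - U B n x\<bar> \<le> 1 * M / B" if "0 < B" for B n x
    using game_value_step[OF _ _ lip, of "1 / B" n x] that by (simp add: U_def)
  have upper: "\<forall>\<^sub>F B in sequentially. U B B 0 < V 0 0 + 5 * \<delta>" if "0 < \<delta>" for \<delta>
  proof (rule scheme_le_supersolution[where H = "Ham \<nu>" and g = gterm and L = 1 and M = M and U = U])
    fix B n x c p k assume *: "0 < B" "0 \<le> k" "\<And>z. U B n (x + z) \<le> c + p \<bullet> z + k * (norm z)\<^sup>2"
    then show "U B (Suc n) x \<le> c + Ham \<nu> p / B + k * (M / B)\<^sup>2"
      using game_value_consistent_upper[OF _ _ lip, of "1 / B" n x c p k]
      by (simp add: U_def Ham_eq_minimax[OF game])
  qed (use H M_nonneg V U0 Ulip Ustep that viscosity_solution_supersolution[OF assms(4)] in auto)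
  \<comment> \<open>The upper consistency of \<open>-U\<close> is the lower consistency of the game
    value with \<open>c\<close> and \<open>p\<close> negated.\<close>
  have lower: "\<forall>\<^sub>F B in sequentially. - U B B 0 < - V 0 0 + 5 * \<delta>" if "0 < \<delta>" for \<delta>
  proof (rule scheme_le_supersolution[where H = "\<lambda>p. - Ham \<nu> (- p)" and g = "\<lambda>x. - gterm x"
        and L = 1 and M = M and U = "\<lambda>B n x. - U B n x" and V = "\<lambda>x t. - V x t"])
    fix p q show "- Ham \<nu> (- p) \<le> - Ham \<nu> (- q) + M * norm (p - q)"
      using H[of "- q" "- p"] by simp
  next
    show "continuous_on (UNIV \<times> {0..1}) (\<lambda>(x, t). - V x t)"
      using continuous_on_minus[OF V(1)] by (simp add: case_prod_unfold)
  next
    fix B n x y assume "0 < (B::nat)"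
    then show "\<bar>- U B n x - - U B n y\<bar> \<le> 1 * norm (x - y)" "\<bar>- U B (Suc n) x - - U B n x\<bar> \<le> 1 * M / B"
      using Ulip[of B n x y] Ustep[of B n x] by (simp_all add: abs_le_iff)
  next
    fix B n x c p k assume *: "0 < B" "0 \<le> k" "\<And>z. - U B n (x + z) \<le> c + p \<bullet> z + k * (norm z)\<^sup>2"
    have "- c + - p \<bullet> z - k * (norm z)\<^sup>2 \<le> U B n (x + z)" for z
      using *(3)[of z] by simp
    then show "- U B (Suc n) x \<le> c + - Ham \<nu> (- p) / B + k * (M / B)\<^sup>2"
      using game_value_consistent_lower[OF _ _ lip, of "1 / B" "- c" "- p" k n x] *
      by (simp add: U_def Ham_eq_minimax[OF game])
  qed (use M_nonneg V U0 that viscosity_solution_uminus_supersolution[OF assms(4)] in auto)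
  have "(\<lambda>B. U B B 0) \<longlonglongrightarrow> V 0 0"
  proof (rule tendstoI)
    fix e :: real assume "0 < e"
    then show "\<forall>\<^sub>F B in sequentially. dist (U B B 0) (V 0 0) < e"
      using upper[of "e / 5"] lower[of "e / 5"] by (auto simp: dist_real_def elim: eventually_elim2)
  qed
  moreover have "\<forall>\<^sub>F B in sequentially. U B B 0 = R_go \<nu> B"
    using eventually_gt_at_top[of 0]
    by eventually_elim (simp add: U_def R_go_eq_game_value[OF assms(1) game])
  ultimately show ?thesis by (rule Lim_transform_eventually)
qed

end
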